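(* Let $a, b$ be two positive real numbers and $\nu \in (0,1)$. Then $$a\nabla_{\nu} b \leq a\sharp_{\nu} b + (\sqrt a-\sqrt b)^2 - \sum_{k=0}^{\infty} r_k\Big[\big(a^{\frac{m_k}{2^k}} b^{1-\frac{m_k}{2^k}}\big)^{\frac12} - \big(a^{\frac{m_k+1}{2^k}} b^{1-\frac{m_k+1}{2^k}}\big)^{\frac12}\Big]^2 .$$
   Context: For positive reals $a,b$ and $\nu\in[0,1]$: $a\nabla_\nu b = (1-\nu)a+\nu b$ and $a\sharp_\nu b = a^{1-\nu}b^{\nu}$. For $0<\nu<1$ and integers $k\ge 0$, $m_k=\lfloor 2^k\nu\rfloor$ is the largest integer not greater than $2^k\nu$; $r_0=\min\{\nu,1-\nu\}$ and $r_k=\min\{2r_{k-1},\,1-2r_{k-1}\}$ for $k\ge 1$. The infinite series has nonnegative terms and is convergent. *)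

theory Defs
  imports Complex_Main
begin

definition weighted_am :: "real \<Rightarrow> real \<Rightarrow> real \<Rightarrow> real" where
  "weighted_am \<nu> a b = (1 - \<nu>) * a + \<nu> * b"

definition weighted_gm :: "real \<Rightarrow> real \<Rightarrow> real \<Rightarrow> real" where
  "weighted_gm \<nu> a b = a powr (1 - \<nu>) * b powr \<nu>"

definition dyadic_floor :: "real \<Rightarrow> nat \<Rightarrow> int" where
  "dyadic_floor \<nu> k = \<lfloor>2 ^ k * \<nu>\<rfloor>"

primrec young_coeff :: "real \<Rightarrow> nat \<Rightarrow> real" where
  "young_coeff \<nu> 0 = min \<nu> (1 - \<nu>)"
| "young_coeff \<nu> (Suc k) = min (2 * young_coeff \<nu> k) (1 - 2 * young_coeff \<nu> k)"

text \<open>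
  The general term of the series.  The exponents of \<open>a\<close> and \<open>b\<close> are interchanged in
  comparison with \<^const>\<open>weighted_gm\<close>: here \<open>a\<close> carries the dyadic weight and \<open>b\<close> its
  complement.
\<close>

definition reverse_young_term :: "real \<Rightarrow> real \<Rightarrow> real \<Rightarrow> nat \<Rightarrow> real" where
  "reverse_young_term \<nu> a b k =
     (let s = real_of_int (dyadic_floor \<nu> k) / 2 ^ k;
          t = (real_of_int (dyadic_floor \<nu> k) + 1) / 2 ^ k
      in young_coeff \<nu> k *
           ((a powr s * b powr (1 - s)) powr (1 / 2)
            - (a powr t * b powr (1 - t)) powr (1 / 2)) ^ 2)"

end

theory Submission
  imports Defs
begin

text \<open>
  Let \<open>f x = a\<^sup>x b\<^sup>1\<^sup>-\<^sup>x\<close> and let \<open>L\<^sub>k\<close> be its piecewise linear interpolant on the dyadic grid of mesh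
  \<open>2\<^sup>-\<^sup>k\<close>.  The \<open>k\<close>-th term of the series is \<open>L\<^sub>k \<nu> - L\<^sub>k\<^sub>+\<^sub>1 \<nu>\<close>, because \<open>r\<^sub>k\<close> is the distance from
  \<open>2\<^sup>k \<nu>\<close> to the nearest integer and the square is a second difference of \<open>f\<close>.  The partial sums
  telescope, and \<open>L\<^sub>n \<ge> f\<close> by convexity, so the series is at most
  \<open>\<nu> a + (1 - \<nu>) b - f \<nu>\<close>.  What remains is \<open>f \<nu> + f (1 - \<nu>) \<ge> 2 \<surd>(a b)\<close>, which holds
  because \<open>f \<nu> * f (1 - \<nu>) = a b\<close>.
\<close>

definition dyadic_interpolant :: "(real \<Rightarrow> real) \<Rightarrow> real \<Rightarrow> nat \<Rightarrow> real" where
  "dyadic_interpolant f x k =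
     (1 - frac (2 ^ k * x)) * f (real_of_int (dyadic_floor x k) / 2 ^ k)
     + frac (2 ^ k * x) * f ((real_of_int (dyadic_floor x k) + 1) / 2 ^ k)"

lemma floor_double:
  fixes y :: real
  shows "\<lfloor>2 * y\<rfloor> = 2 * \<lfloor>y\<rfloor> + (if frac y < 1 / 2 then 0 else 1)"
  by (rule floor_unique) (use frac_lt_1[of y] in \<open>auto simp: frac_def\<close>)

lemma frac_double:
  fixes y :: real
  shows "frac (2 * y) = (if frac y < 1 / 2 then 2 * frac y else 2 * frac y - 1)"
  using floor_double[of y] by (auto simp: frac_def)

lemma dyadic_floor_Suc:
  "dyadic_floor x (Suc k) = 2 * dyadic_floor x k + (if frac (2 ^ k * x) < 1 / 2 then 0 else 1)"
  using floor_double[of "2 ^ k * x"] by (simp add: dyadic_floor_def mult.assoc)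

text \<open>If \<open>r\<close> is the distance from \<open>y\<close> to the nearest integer, that
  of \<open>2 * y\<close> is \<open>min (2 * r) (1 - 2 * r)\<close>: the recursion is the tent map,
  conjugate to doubling.\<close>

lemma young_coeff_eq_frac:
  assumes "0 < \<nu>" and "\<nu> < 1"
  shows "young_coeff \<nu> k = min (frac (2 ^ k * \<nu>)) (1 - frac (2 ^ k * \<nu>))"
proof (induction k)
  case 0
  have "frac \<nu> = \<nu>"
    using assms by (simp add: frac_eq)
  then show ?case by simp
next
  case (Suc k)
  have "frac (2 ^ Suc k * \<nu>) = (if frac (2 ^ k * \<nu>) < 1 / 2 then 2 * frac (2 ^ k * \<nu>)
      else 2 * frac (2 ^ k * \<nu>) - 1)"
    using frac_double[of "2 ^ k * \<nu>"] by (simp add: mult.assoc)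
  with Suc show ?case by (auto simp: min_def)
qed

text \<open>Refinement keeps the half of the cell that contains \<open>\<nu>\<close>. The difference
  vanishes at both ends of the old cell and is linear on each half, so it is a tent whose height is
  fixed by the second difference at the midpoint.\<close>

lemma dyadic_interpolant_diff:
  assumes "0 < \<nu>" and "\<nu> < 1"
  defines "s \<equiv> \<lambda>k. real_of_int (dyadic_floor \<nu> k) / 2 ^ k"
    and "t \<equiv> \<lambda>k. (real_of_int (dyadic_floor \<nu> k) + 1) / 2 ^ k"
  shows "dyadic_interpolant f \<nu> k - dyadic_interpolant f \<nu> (Suc k)
     = young_coeff \<nu> k * (f (s k) + f (t k) - 2 * f ((s k + t k) / 2))"
proof -
  have frac: "frac (2 ^ Suc k * \<nu>) = (if frac (2 ^ k * \<nu>) < 1 / 2 then 2 * frac (2 ^ k * \<nu>)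
      else 2 * frac (2 ^ k * \<nu>) - 1)"
    using frac_double[of "2 ^ k * \<nu>"] by (simp add: mult.assoc)
  have L: "dyadic_interpolant f \<nu> j = (1 - frac (2 ^ j * \<nu>)) * f (s j) + frac (2 ^ j * \<nu>) * f (t j)"
    for j by (simp add: dyadic_interpolant_def s_def t_def)
  show ?thesis
  proof (cases "frac (2 ^ k * \<nu>) < 1 / 2")
    case True
    then have "s (Suc k) = s k" "t (Suc k) = (s k + t k) / 2"
      by (simp_all add: s_def t_def dyadic_floor_Suc field_simps)
    moreover have "young_coeff \<nu> k = frac (2 ^ k * \<nu>)"
      using True by (simp add: young_coeff_eq_frac[OF assms(1,2)])
    ultimately show ?thesis
      using True by (simp only: L frac if_True) (simp add: algebra_simps)
  next
    case False
    then have "s (Suc k) = (s k + t k) / 2" "t (Suc k) = t k"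
      by (simp_all add: s_def t_def dyadic_floor_Suc field_simps)
    moreover have "young_coeff \<nu> k = 1 - frac (2 ^ k * \<nu>)"
      using False by (simp add: young_coeff_eq_frac[OF assms(1,2)])
    ultimately show ?thesis
      using False by (simp only: L frac if_False) (simp add: algebra_simps)
  qed
qed

lemma exp_convex_combination:
  fixes u v x :: real
  assumes "0 \<le> x" and "x \<le> 1"
  shows "exp ((1 - x) * u + x * v) \<le> (1 - x) * exp u + x * exp v"
proof -
  let ?w = "(1 - x) * u + x * v"
  \<comment> \<open>Tangent line at the mean \<open>?w\<close>; averaging it over \<open>u\<close>
    and \<open>v\<close> cancels the linear part and leaves \<open>exp ?w\<close>.\<close>
  have tangent: "exp ?w * (1 + (z - ?w)) \<le> exp z" for z
    using mult_left_mono[OF exp_ge_add_one_self[of "z - ?w"], of "exp ?w"]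
    by (simp add: exp_diff)
  have "exp ?w = (1 - x) * (exp ?w * (1 + (u - ?w))) + x * (exp ?w * (1 + (v - ?w)))"
    by (simp add: algebra_simps)
  also have "\<dots> \<le> (1 - x) * exp u + x * exp v"
    using assms by (intro add_mono mult_left_mono tangent) auto
  finally show ?thesis .
qed

lemma le_dyadic_interpolant_exp_affine:
  fixes c d x :: real
  shows "exp (c * x + d) \<le> dyadic_interpolant (\<lambda>z. exp (c * z + d)) x k"
proof -
  let ?p = "frac (2 ^ k * x)" and ?m = "real_of_int (dyadic_floor x k)"
  have "2 ^ k * x = ?m + ?p"
    by (simp add: frac_def dyadic_floor_def)
  then have x: "x = (?m + ?p) / 2 ^ k"
    by (simp add: field_simps)
  \<comment> \<open>\<open>x\<close> divides its cell in the ratio given by \<open>?p\<close>, and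
    affine maps preserve such ratios.\<close>
  have "c * x + d = (1 - ?p) * (c * (?m / 2 ^ k) + d) + ?p * (c * ((?m + 1) / 2 ^ k) + d)"
    by (subst x) (simp add: field_simps)
  then show ?thesis
    unfolding dyadic_interpolant_def
    using exp_convex_combination[of ?p] frac_lt_1[of "2 ^ k * x"] by simp
qed

theorem theorem2p4:
  fixes a b \<nu> :: real
  assumes "a > 0" and "b > 0" and "0 < \<nu>" and "\<nu> < 1"
  shows "summable (reverse_young_term \<nu> a b) \<and>
         weighted_am \<nu> a b \<le> weighted_gm \<nu> a b + (sqrt a - sqrt b) ^ 2
           - (\<Sum>k. reverse_young_term \<nu> a b k)"
proof -
  define f where "f = (\<lambda>z. exp ((ln a - ln b) * z + ln b))"
  have powr: "a powr z * b powr (1 - z) = f z" for z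
    using assms by (simp add: f_def powr_def exp_add [symmetric] algebra_simps)
  \<comment> \<open>Since \<open>ln (f z)\<close> is affine in \<open>z\<close>, the geometric mean
    of \<open>f y\<close> and \<open>f z\<close> is \<open>f\<close> at the midpoint.\<close>
  have square: "(f y powr (1 / 2) - f z powr (1 / 2))\<^sup>2 = f y + f z - 2 * f ((y + z) / 2)" for y z
  proof -
    have "f y powr (1 / 2) * f z powr (1 / 2) = f ((y + z) / 2)"
      by (simp add: f_def powr_def exp_add [symmetric] field_simps)
    moreover have "(f w powr (1 / 2))\<^sup>2 = f w" for w
      by (simp add: f_def powr_half_sqrt)
    ultimately show ?thesis by (simp add: power2_diff)
  qed
  have term_eq: "reverse_young_term \<nu> a b k = dyadic_interpolant f \<nu> k - dyadic_interpolant f \<nu> (Suc k)"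
    for k
    by (simp only: reverse_young_term_def Let_def powr square dyadic_interpolant_diff[OF assms(3,4)])
  have nonneg: "0 \<le> reverse_young_term \<nu> a b k" for k
    using frac_ge_0[of "2 ^ k * \<nu>"] frac_lt_1[of "2 ^ k * \<nu>"]
    by (auto simp: reverse_young_term_def Let_def young_coeff_eq_frac[OF assms(3,4)]
        intro!: mult_nonneg_nonneg)
  have "\<lfloor>\<nu>\<rfloor> = 0"
    using assms by (simp add: floor_eq_iff)
  \<comment> \<open>The coarsest cell is [0, 1], with \<open>f 0 = b\<close> and
    \<open>f 1 = a\<close>.\<close>
  then have L0: "dyadic_interpolant f \<nu> 0 = (1 - \<nu>) * b + \<nu> * a"
    using assms by (simp add: dyadic_interpolant_def dyadic_floor_def frac_def f_def)
  have partial: "(\<Sum>k<n. reverse_young_term \<nu> a b k) \<le> (1 - \<nu>) * b + \<nu> * a - f \<nu>" for n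
  proof -
    have "(\<Sum>k<n. reverse_young_term \<nu> a b k) = dyadic_interpolant f \<nu> 0 - dyadic_interpolant f \<nu> n"
      by (simp only: term_eq sum_lessThan_telescope')
    moreover have "f \<nu> \<le> dyadic_interpolant f \<nu> n"
      unfolding f_def by (rule le_dyadic_interpolant_exp_affine)
    ultimately show ?thesis
      by (simp add: L0)
  qed
  have summable: "summable (reverse_young_term \<nu> a b)"
    by (rule summableI_nonneg_bounded[OF nonneg partial])
  have "(\<Sum>k. reverse_young_term \<nu> a b k) \<le> (1 - \<nu>) * b + \<nu> * a - f \<nu>"
    by (rule suminf_le_const[OF summable partial])
  moreover have "weighted_gm \<nu> a b = f (1 - \<nu>)"
    using powr[of "1 - \<nu>"] by (simp add: weighted_gm_def)
  moreover have "2 * (sqrt a * sqrt b) \<le> f \<nu> + f (1 - \<nu>)"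
  proof -
    have "f (1 / 2) = sqrt a * sqrt b"
      using powr[of "1 / 2"] assms by (simp add: powr_half_sqrt)
    \<comment> \<open>The points \<open>\<nu>\<close> and \<open>1 - \<nu>\<close> have midpoint
      1/2, so this expression is itself a square.\<close>
    moreover have "0 \<le> f \<nu> + f (1 - \<nu>) - 2 * f (1 / 2)"
      using square[of \<nu> "1 - \<nu>"] by (metis add.commute diff_add_cancel zero_le_power2)
    ultimately show ?thesis by simp
  qed
  moreover have "(sqrt a - sqrt b)\<^sup>2 = a + b - 2 * (sqrt a * sqrt b)"
    using assms by (simp add: power2_diff)
  \<comment> \<open>The weighted mean and its mirror image
    \<open>(1 - \<nu>) * b + \<nu> * a\<close> add up to \<open>a + b\<close>.\<close>
  ultimately show ?thesis
    using summable by (simp add: weighted_am_def algebra_simps)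
qed

end
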